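(* Let $\alpha\in(0,1)$, $\beta\in(1,2)$, $\sigma=1-\frac{\alpha}{2}$. The two-dimensional fully discrete scheme in the context is unconditionally stable: there is a positive constant $C$ (independent of $\tau$, $h$ and the data) such that, provided $\tau$ and $h$ are sufficiently small, $$\|\mathbf U^n\|^2_{L^2_h}\le\|\mathbf U^0\|^2_{L^2_h}+\frac{8\pi^{2+\beta}\Gamma(1-\alpha)}{C\,\tilde a^{\alpha}\,2^{\frac{3\beta}{2}}}\max_{0\le k\le n-1}\Big\{\big((k+\sigma)\tau\big)^{\alpha}\|\mathbf F^{k+\sigma}\|^2_{L^2_h}\Big\},\qquad 1\le n\le N.$$
   Context: Time grid: $\tilde a>0$, $T>\tilde a$, $N\in\mathbb{Z}^+$, $\tau=(T-\tilde a)/N$, $t_k=\tilde a+k\tau$, $t_{k+\sigma}=t_k+\sigma\tau$. L2-1$_\sigma$ coefficients: for $1\le i\le k$, $a^{(\alpha,\sigma)}_{i,k}=(\log\frac{t_{k+\sigma}}{t_{i-1}})^{1-\alpha}-(\log\frac{t_{k+\sigma}}{t_{i}})^{1-\alpha}$, $b^{(\alpha,\sigma)}_{i,k}=\frac{1}{\log\frac{t_{i+1}}{t_{i-1}}}\{\frac{2}{2-\alpha}[(\log\frac{t_{k+\sigma}}{t_{i-1}})^{2-\alpha}-(\log\frac{t_{k+\sigma}}{t_{i}})^{2-\alpha}]-\log\frac{t_i}{t_{i-1}}[(\log\frac{t_{k+\sigma}}{t_{i}})^{1-\alpha}+(\log\frac{t_{k+\sigma}}{t_{i-1}})^{1-\alpha}]\}$;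 $c^{(\alpha,\sigma)}_{1,0}=\frac{(\log\frac{t_\sigma}{t_0})^{1-\alpha}}{\Gamma(2-\alpha)\log\frac{t_1}{t_0}}$; for $k\ge1$: $c^{(\alpha,\sigma)}_{1,k}=\frac{a^{(\alpha,\sigma)}_{1,k}-b^{(\alpha,\sigma)}_{1,k}}{\Gamma(2-\alpha)\log\frac{t_1}{t_0}}$, $c^{(\alpha,\sigma)}_{i,k}=\frac{a^{(\alpha,\sigma)}_{i,k}+b^{(\alpha,\sigma)}_{i-1,k}-b^{(\alpha,\sigma)}_{i,k}}{\Gamma(2-\alpha)\log\frac{t_i}{t_{i-1}}}$ ($2\le i\le k$), $c^{(\alpha,\sigma)}_{k+1,k}=\frac{b^{(\alpha,\sigma)}_{k,k}+(\log\frac{t_{k+\sigma}}{t_k})^{1-\alpha}}{\Gamma(2-\alpha)\log\frac{t_{k+1}}{t_k}}$. Space grid: $L>0$, $M\in\mathbb{Z}^+$, $h=2L/M$, $x_j=-L+jh$, $y_k=-L+kh$; grid functions $w=\{w_{jk}\}$ are set to $0$ unless $1\le j,k\le M-1$; $(w,v)_{h^2}=h^2\sum_{j,k=1}^{M-1}w_{jk}v_{jk}$, $\|w\|^2_{L^2_h}=(w,w)_{h^2}$. Fractional centered difference: $((-\Delta_h)^{\beta/2}w)_{jk}=h^{-\beta}\sum_{l,m\in\mathbb{Z}}a^{(\beta)}_{l,m}w_{j+l,k+m}$, $a^{(\beta)}_{l,m}=\frac{1}{4\pi^2}\int_{-\pi}^{\pi}\int_{-\pi}^{\pi}[4\sin^2\frac{\eta_1}{2}+4\sin^2\frac{\eta_2}{2}]^{\beta/2}e^{-\mathbf{i}(\eta_1l+\eta_2m)}d\eta_1d\eta_2$.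 Scheme: given $u_0$ and $f$, let $\mathbf F^{n+\sigma}=(f(x_j,y_k,t_{n+\sigma}))_{j,k}$ and find $\mathbf U^n=(U^n_{jk})$ with $\sum_{i=1}^{n+1}c^{(\alpha,\sigma)}_{i,n}(U^i_{jk}-U^{i-1}_{jk})+\big((-\Delta_h)^{\beta/2}(\sigma U^{n+1}+(1-\sigma)U^n)\big)_{jk}=f(x_j,y_k,t_{n+\sigma})$ for $0\le n\le N-1$, $1\le j,k\le M-1$; $U^0_{jk}=u_0(x_j,y_k)$; $U^n_{jk}=0$ at boundary grid points. *)

theory Defs
  imports "HOL-Analysis.Analysis"
begin

text \<open>Time grid: t_s = a + s * tau (s real, to allow t_{k+sigma}).\<close>
definition tg :: "real \<Rightarrow> real \<Rightarrow> real \<Rightarrow> real" where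
  "tg a tau s = a + s * tau"

text \<open>L2-1_sigma auxiliary coefficients a_{i,k}, b_{i,k}.\<close>
definition acf :: "real \<Rightarrow> real \<Rightarrow> real \<Rightarrow> real \<Rightarrow> nat \<Rightarrow> nat \<Rightarrow> real" where
  "acf \<alpha> \<sigma> a tau i k =
     (ln (tg a tau (real k + \<sigma>) / tg a tau (real i - 1))) powr (1 - \<alpha>)
   - (ln (tg a tau (real k + \<sigma>) / tg a tau (real i))) powr (1 - \<alpha>)"

definition bcf :: "real \<Rightarrow> real \<Rightarrow> real \<Rightarrow> real \<Rightarrow> nat \<Rightarrow> nat \<Rightarrow> real" where
  "bcf \<alpha> \<sigma> a tau i k =
     (1 / ln (tg a tau (real i + 1) / tg a tau (real i - 1))) *
     ( (2 / (2 - \<alpha>)) *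
         ((ln (tg a tau (real k + \<sigma>) / tg a tau (real i - 1))) powr (2 - \<alpha>)
          - (ln (tg a tau (real k + \<sigma>) / tg a tau (real i))) powr (2 - \<alpha>))
     - ln (tg a tau (real i) / tg a tau (real i - 1)) *
         ((ln (tg a tau (real k + \<sigma>) / tg a tau (real i))) powr (1 - \<alpha>)
          + (ln (tg a tau (real k + \<sigma>) / tg a tau (real i - 1))) powr (1 - \<alpha>)))"

text \<open>Coefficients c_{i,k}^{(alpha,sigma)}, meaningful for 1 <= i <= k+1.\<close>
definition ccf :: "real \<Rightarrow> real \<Rightarrow> real \<Rightarrow> real \<Rightarrow> nat \<Rightarrow> nat \<Rightarrow> real" where
  "ccf \<alpha> \<sigma> a tau i k =
    (if k = 0 then
        (ln (tg a tau \<sigma> / tg a tau 0)) powr (1 - \<alpha>)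
          / (Gamma (2 - \<alpha>) * ln (tg a tau 1 / tg a tau 0))
     else if i = 1 then
        (acf \<alpha> \<sigma> a tau 1 k - bcf \<alpha> \<sigma> a tau 1 k)
          / (Gamma (2 - \<alpha>) * ln (tg a tau 1 / tg a tau 0))
     else if i \<le> k then
        (acf \<alpha> \<sigma> a tau i k + bcf \<alpha> \<sigma> a tau (i - 1) k - bcf \<alpha> \<sigma> a tau i k)
          / (Gamma (2 - \<alpha>) * ln (tg a tau (real i) / tg a tau (real i - 1)))
     else
        (bcf \<alpha> \<sigma> a tau k k + (ln (tg a tau (real k + \<sigma>) / tg a tau (real k))) powr (1 - \<alpha>))
          / (Gamma (2 - \<alpha>) * ln (tg a tau (real k + 1) / tg a tau (real k))))"

definition gext :: "nat \<Rightarrow> (int \<Rightarrow> int \<Rightarrow> real) \<Rightarrow> int \<Rightarrow> int \<Rightarrow> real" where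
  "gext M w j k = (if 1 \<le> j \<and> j \<le> int M - 1 \<and> 1 \<le> k \<and> k \<le> int M - 1 then w j k else 0)"

definition fcoef :: "real \<Rightarrow> int \<Rightarrow> int \<Rightarrow> complex" where
  "fcoef \<beta> l m = complex_of_real (1 / (4 * pi\<^sup>2)) *
     integral (cbox (-pi, -pi) (pi, pi))
       (\<lambda>(\<eta>1, \<eta>2). complex_of_real ((4 * (sin (\<eta>1 / 2))\<^sup>2 + 4 * (sin (\<eta>2 / 2))\<^sup>2) powr (\<beta> / 2))
          * exp (- \<i> * complex_of_real (\<eta>1 * real_of_int l + \<eta>2 * real_of_int m)))"

definition fraclap :: "real \<Rightarrow> real \<Rightarrow> nat \<Rightarrow> (int \<Rightarrow> int \<Rightarrow> real) \<Rightarrow> int \<Rightarrow> int \<Rightarrow> complex" where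
  "fraclap \<beta> h M w j k = complex_of_real (h powr (- \<beta>)) *
     infsum (\<lambda>(l, m). fcoef \<beta> l m * complex_of_real (gext M w (j + l) (k + m))) UNIV"

definition gnorm2 :: "real \<Rightarrow> nat \<Rightarrow> (int \<Rightarrow> int \<Rightarrow> real) \<Rightarrow> real" where
  "gnorm2 h M w = h\<^sup>2 * (\<Sum>j\<in>{1..int M - 1}. \<Sum>k\<in>{1..int M - 1}. (w j k)\<^sup>2)"

end

theory Submission
  imports Defs
begin

text \<open>
  In the variable \<open>s = ln t\<close> the scheme is the L2-1\<open>\<^sub>\<sigma>\<close> formula on a slowly varying grid. With the kernel
  \<open>g(s) = (1-\<alpha>)(s\<^sup>* - s)\<^bsup>-\<alpha>\<^esup>\<close>, \<open>s\<^sup>* = ln t\<^bsub>k+\<sigma>\<^esub>\<close>, one has \<open>g(s\<^sub>i\<^sub>-\<^sub>1) \<le> \<Gamma>(2-\<alpha>) c\<^sub>i\<^sub>,\<^sub>k \<le> g(s\<^sub>i)\<close> for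
  \<open>i \<le> k\<close>, while \<open>(1-\<alpha>) \<Gamma>(2-\<alpha>) c\<^sub>k\<^sub>+\<^sub>1\<^sub>,\<^sub>k \<ge> \<sigma> g(s\<^sub>k)\<close> by concavity of the logarithm. Hence the coefficients
  increase in \<open>i\<close>, satisfy \<open>(2\<sigma>-1) c\<^sub>k\<^sub>+\<^sub>1\<^sub>,\<^sub>k \<ge> \<sigma> c\<^sub>k\<^sub>,\<^sub>k\<close>, and \<open>c\<^sub>1\<^sub>,\<^sub>k\<close> is bounded below by a multiple of
  \<open>((k+\<sigma>)\<tau>)\<^bsup>-\<alpha>\<^esup>\<close>. Testing the scheme with \<open>\<sigma> U\<^sup>n\<^sup>+\<^sup>1 + (1-\<sigma>) U\<^sup>n\<close> and using that the discrete fractional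
  Laplacian is coercive uniformly in \<open>h\<close> gives an inequality for \<open>\<parallel>U\<^sup>n\<parallel>\<^sup>2\<close> that summation by parts
  closes inductively.
\<close>

section \<open>Taylor bounds for powers\<close>

lemma powr_tangent_defect_deriv:
  fixes \<alpha> p x :: real
  assumes "0 < x"
  shows "((\<lambda>x. x powr (1 - \<alpha>) - p powr (1 - \<alpha>) - (x - p) * ((1 - \<alpha>) * x powr (- \<alpha>)))
           has_real_derivative (x - p) * (\<alpha> * (1 - \<alpha>) * x powr (- \<alpha> - 1))) (at x)"
  using assms by (auto intro!: derivative_eq_intros simp: algebra_simps)

text \<open>The difference of the two sides is the derivative of \<open>trap \<alpha> p\<close> at
  \<open>q\<close>, so its sign decides that of the trapezoidal defect.\<close>

lemma powr_tangent_defect_nonneg: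
  fixes \<alpha> p q :: real
  assumes "0 < \<alpha>" "\<alpha> < 1" "0 < p" "p \<le> q"
  shows "(q - p) * ((1 - \<alpha>) * q powr (- \<alpha>)) \<le> q powr (1 - \<alpha>) - p powr (1 - \<alpha>)"
proof -
  let ?f = "\<lambda>x. x powr (1 - \<alpha>) - p powr (1 - \<alpha>) - (x - p) * ((1 - \<alpha>) * x powr (- \<alpha>))"
  have "?f p \<le> ?f q"
  proof (rule DERIV_nonneg_imp_nondecreasing[OF assms(4)])
    fix x assume "p \<le> x" "x \<le> q"
    then show "\<exists>y. (?f has_real_derivative y) (at x) \<and> 0 \<le> y"
      using assms by (intro exI[of _ "(x - p) * (\<alpha> * (1 - \<alpha>) * x powr (- \<alpha> - 1))"] conjI
          powr_tangent_defect_deriv) auto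
  qed
  then show ?thesis by simp
qed

text \<open>Integrated once in \<open>q\<close>, this quadratic bound becomes the cubic bound
  \<open>trap_le\<close>.\<close>

lemma powr_tangent_defect_le:
  fixes \<alpha> p q :: real
  assumes "0 < \<alpha>" "\<alpha> < 1" "0 < p" "p \<le> q"
  shows "q powr (1 - \<alpha>) - p powr (1 - \<alpha>) - (q - p) * ((1 - \<alpha>) * q powr (- \<alpha>))
           \<le> \<alpha> * (1 - \<alpha>) * p powr (- \<alpha> - 1) * (q - p)\<^sup>2 / 2"
proof -
  let ?K = "\<alpha> * (1 - \<alpha>) * p powr (- \<alpha> - 1)"
  let ?f = "\<lambda>x. ?K * (x - p)\<^sup>2 / 2
              - (x powr (1 - \<alpha>) - p powr (1 - \<alpha>) - (x - p) * ((1 - \<alpha>) * x powr (- \<alpha>)))"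
  have "?f p \<le> ?f q"
  proof (rule DERIV_nonneg_imp_nondecreasing[OF assms(4)])
    fix x assume x: "p \<le> x" "x \<le> q"
    let ?y = "?K * (x - p) - (x - p) * (\<alpha> * (1 - \<alpha>) * x powr (- \<alpha> - 1))"
    have "(?f has_real_derivative ?y) (at x)"
      using x assms by (intro DERIV_diff powr_tangent_defect_deriv)
        (auto intro!: derivative_eq_intros)
    moreover have "x powr (- \<alpha> - 1) \<le> p powr (- \<alpha> - 1)"
      using x assms by (intro powr_mono2') auto
    then have "(x - p) * (\<alpha> * (1 - \<alpha>)) * x powr (- \<alpha> - 1)
                 \<le> (x - p) * (\<alpha> * (1 - \<alpha>)) * p powr (- \<alpha> - 1)"
      using x assms by (intro mult_left_mono) auto
    then have "0 \<le> ?y" by (simp add: mult_ac)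
    ultimately show "\<exists>y. (?f has_real_derivative y) (at x) \<and> 0 \<le> y" by blast
  qed
  then show ?thesis by simp
qed

text \<open>The quadratic surplus is kept because it must later absorb b_{i-1,k}.\<close>

lemma powr_secant_defect_ge:
  fixes \<alpha> p q :: real
  assumes "0 < \<alpha>" "\<alpha> < 1" "0 < p" "p \<le> q"
  shows "\<alpha> * (1 - \<alpha>) * q powr (- \<alpha> - 1) * (q - p)\<^sup>2 / 2
           \<le> (q - p) * ((1 - \<alpha>) * p powr (- \<alpha>)) - (q powr (1 - \<alpha>) - p powr (1 - \<alpha>))"
proof -
  let ?K = "\<alpha> * (1 - \<alpha>) * q powr (- \<alpha> - 1)"
  \<comment> \<open>The left endpoint moves while \<open>q\<close> stays fixed, so the constant
    \<open>?K\<close> uses the least value of the second derivative's power on the interval.\<close>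
  let ?f = "\<lambda>x. (q - x) * ((1 - \<alpha>) * x powr (- \<alpha>)) - (q powr (1 - \<alpha>) - x powr (1 - \<alpha>))
              - ?K * (q - x)\<^sup>2 / 2"
  have "?f q \<le> ?f p"
  proof (rule DERIV_nonpos_imp_nonincreasing[OF assms(4)])
    fix x assume x: "p \<le> x" "x \<le> q"
    let ?y = "?K * (q - x) - (q - x) * (\<alpha> * (1 - \<alpha>) * x powr (- \<alpha> - 1))"
    have 1: "((\<lambda>x. ?K * (q - x)\<^sup>2 / 2) has_real_derivative - (?K * (q - x))) (at x)"
      by (auto intro!: derivative_eq_intros) (simp add: algebra_simps)
    have 2: "((\<lambda>x. (q - x) * ((1 - \<alpha>) * x powr (- \<alpha>)) - (q powr (1 - \<alpha>) - x powr (1 - \<alpha>)))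
      has_real_derivative - ((q - x) * (\<alpha> * (1 - \<alpha>) * x powr (- \<alpha> - 1)))) (at x)"
      using x assms by (auto intro!: derivative_eq_intros simp: algebra_simps)
    have "(?f has_real_derivative ?y) (at x)"
      by (rule DERIV_cong[OF DERIV_diff[OF 2 1]]) simp
    moreover have "q powr (- \<alpha> - 1) \<le> x powr (- \<alpha> - 1)"
      using x assms by (intro powr_mono2') auto
    then have "(q - x) * (\<alpha> * (1 - \<alpha>)) * q powr (- \<alpha> - 1)
                 \<le> (q - x) * (\<alpha> * (1 - \<alpha>)) * x powr (- \<alpha> - 1)"
      using x assms by (intro mult_left_mono) auto
    then have "?y \<le> 0" by (simp add: mult_ac)
    ultimately show "\<exists>y. (?f has_real_derivative y) (at x) \<and> y \<le> 0" by blast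
  qed
  then show ?thesis by simp
qed

text \<open>Twice the defect of the trapezoidal rule for \<open>\<integral>\<^sub>p\<^sup>q x\<^bsup>1-\<alpha>\<^esup> dx\<close>; the numerator of \<open>b\<^sub>i\<^sub>,\<^sub>k\<close>.\<close>
definition trap :: "real \<Rightarrow> real \<Rightarrow> real \<Rightarrow> real" where
  "trap \<alpha> p q = (2 / (2 - \<alpha>)) * (q powr (2 - \<alpha>) - p powr (2 - \<alpha>))
     - (q - p) * (p powr (1 - \<alpha>) + q powr (1 - \<alpha>))"

lemma trap_deriv:
  assumes "0 < x" "\<alpha> < 1"
  shows "((\<lambda>x. trap \<alpha> p x) has_real_derivative
           (x powr (1 - \<alpha>) - p powr (1 - \<alpha>) - (x - p) * ((1 - \<alpha>) * x powr (- \<alpha>)))) (at x)"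
proof -
  have "((\<lambda>x. 2 / (2 - \<alpha>) * (x powr (2 - \<alpha>) - p powr (2 - \<alpha>)))
          has_real_derivative 2 * x powr (1 - \<alpha>)) (at x)"
    using assms by (auto intro!: derivative_eq_intros)
  moreover have "((\<lambda>x. (x - p) * (p powr (1 - \<alpha>) + x powr (1 - \<alpha>))) has_real_derivative
      (x - p) * ((1 - \<alpha>) * x powr (- \<alpha>)) + (p powr (1 - \<alpha>) + x powr (1 - \<alpha>))) (at x)"
    using assms by (auto intro!: derivative_eq_intros)
  ultimately show ?thesis
    unfolding trap_def by (rule DERIV_diff[THEN DERIV_cong]) simp
qed

lemma trap_nonneg:
  assumes "0 < \<alpha>" "\<alpha> < 1" "0 < p" "p \<le> q"
  shows "0 \<le> trap \<alpha> p q"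
proof -
  have "trap \<alpha> p p \<le> trap \<alpha> p q"
  proof (rule DERIV_nonneg_imp_nondecreasing[OF assms(4)])
    fix x assume x: "p \<le> x" "x \<le> q"
    show "\<exists>y. ((\<lambda>x. trap \<alpha> p x) has_real_derivative y) (at x) \<and> 0 \<le> y"
      using trap_deriv[of x \<alpha> p] powr_tangent_defect_nonneg[of \<alpha> p x] x assms
      by (intro exI conjI) (assumption | simp)+
  qed
  then show ?thesis by (simp add: trap_def)
qed

lemma trap_le:
  assumes "0 < \<alpha>" "\<alpha> < 1" "0 < p" "p \<le> q"
  shows "trap \<alpha> p q \<le> \<alpha> * (1 - \<alpha>) * p powr (- \<alpha> - 1) * (q - p) ^ 3 / 6"
proof -
  let ?K = "\<alpha> * (1 - \<alpha>) * p powr (- \<alpha> - 1)"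
  let ?f = "\<lambda>x. ?K * (x - p) ^ 3 / 6 - trap \<alpha> p x"
  have "?f p \<le> ?f q"
  proof (rule DERIV_nonneg_imp_nondecreasing[OF assms(4)])
    fix x assume x: "p \<le> x" "x \<le> q"
    let ?y = "?K * (x - p)\<^sup>2 / 2
      - (x powr (1 - \<alpha>) - p powr (1 - \<alpha>) - (x - p) * ((1 - \<alpha>) * x powr (- \<alpha>)))"
    have "(?f has_real_derivative ?y) (at x)"
      using x assms by (intro DERIV_diff trap_deriv)
        (auto intro!: derivative_eq_intros simp: power2_eq_square)
    moreover have "0 \<le> ?y" using powr_tangent_defect_le[of \<alpha> p x] x assms by simp
    ultimately show "\<exists>y. (?f has_real_derivative y) (at x) \<and> 0 \<le> y" by blast
  qed
  then show ?thesis by (simp add: trap_def)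
qed

text \<open>The terms with p powr (1 - \<alpha>) cancel. What remains compares the integral of the
  concave function x powr (1 - \<alpha>) over [p, q] with that of its tangent line at
  \<open>q\<close>; \<open>?f x\<close> is twice the area between the two over [x, q].\<close>

lemma trap_le_increment:
  assumes "0 < \<alpha>" "\<alpha> < 1" "0 < p" "p \<le> q"
  shows "trap \<alpha> p q
    \<le> (q - p) * (q powr (1 - \<alpha>) - p powr (1 - \<alpha>)) - (q - p)\<^sup>2 * ((1 - \<alpha>) * q powr (- \<alpha>))"
proof -
  let ?f = "\<lambda>x. 2 * (q - x) * q powr (1 - \<alpha>)
     - (2 / (2 - \<alpha>)) * (q powr (2 - \<alpha>) - x powr (2 - \<alpha>)) - (q - x)\<^sup>2 * ((1 - \<alpha>) * q powr (- \<alpha>))"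
  have "?f q \<le> ?f p"
  proof (rule DERIV_nonpos_imp_nonincreasing[OF assms(4)])
    fix x assume x: "p \<le> x" "x \<le> q"
    let ?y = "2 * ((q - x) * ((1 - \<alpha>) * q powr (- \<alpha>)) - (q powr (1 - \<alpha>) - x powr (1 - \<alpha>)))"
    have "((\<lambda>x. 2 / (2 - \<alpha>) * (q powr (2 - \<alpha>) - x powr (2 - \<alpha>)))
          has_real_derivative - 2 * x powr (1 - \<alpha>)) (at x)"
      using x assms by (auto intro!: derivative_eq_intros)
    moreover have "((\<lambda>x. 2 * (q - x) * q powr (1 - \<alpha>)) has_real_derivative - 2 * q powr (1 - \<alpha>)) (at x)"
      by (auto intro!: derivative_eq_intros)
    moreover have "((\<lambda>x. (q - x)\<^sup>2 * ((1 - \<alpha>) * q powr (- \<alpha>))) has_real_derivative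
        - 2 * (q - x) * ((1 - \<alpha>) * q powr (- \<alpha>))) (at x)"
      by (auto intro!: derivative_eq_intros)
    ultimately have "(?f has_real_derivative ?y) (at x)"
      by (intro DERIV_diff[THEN DERIV_cong, OF DERIV_diff]) (auto simp: algebra_simps)
    moreover have "?y \<le> 0" using powr_tangent_defect_nonneg[of \<alpha> x q] x assms by simp
    ultimately show "\<exists>y. (?f has_real_derivative y) (at x) \<and> y \<le> 0" by blast
  qed
  then show ?thesis by (simp add: trap_def algebra_simps)
qed

section \<open>Summation by parts\<close>

lemma sum_by_parts:
  fixes c x :: "nat \<Rightarrow> real"
  shows "(\<Sum>i\<in>{1..n+1}. c i * (x i - x (i - 1)))
     = c (n + 1) * x (n + 1) - (\<Sum>i\<in>{1..n}. (c (i + 1) - c i) * x i) - c 1 * x 0"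
  by (induction n) (simp_all add: algebra_simps)

text \<open>Subtracting the weighted average \<open>v\<close> from every y_i turns the claim into
  the nonpositivity of the sum of c_i times the differences of (y_i - v)^2. After summation by parts
  every term has a good sign except the one at \<open>n + 1\<close>, which \<open>last\<close>
  balances against the one at \<open>n\<close>.\<close>

lemma weighted_average_energy:
  fixes c y :: "nat \<Rightarrow> real"
  assumes \<sigma>: "1 / 2 \<le> \<sigma>" "\<sigma> \<le> 1"
    and pos: "0 \<le> c 1" and mono: "\<And>i. 1 \<le> i \<Longrightarrow> i \<le> n \<Longrightarrow> c i \<le> c (i + 1)"
    and last: "1 \<le> n \<Longrightarrow> \<sigma> * c n \<le> (2 * \<sigma> - 1) * c (n + 1)"
  shows "(\<Sum>i\<in>{1..n+1}. c i * ((y i)\<^sup>2 - (y (i - 1))\<^sup>2)) / 2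
    \<le> (\<sigma> * y (n + 1) + (1 - \<sigma>) * y n) * (\<Sum>i\<in>{1..n+1}. c i * (y i - y (i - 1)))"
proof -
  define v where "v = \<sigma> * y (n + 1) + (1 - \<sigma>) * y n"
  define d where "d = y (n + 1) - y n"
  have v1: "y (n + 1) - v = (1 - \<sigma>) * d" and v0: "y n - v = - \<sigma> * d"
    by (simp_all add: v_def d_def algebra_simps)
  have "(\<Sum>i\<in>{1..n+1}. c i * ((y i - v)\<^sup>2 - (y (i - 1) - v)\<^sup>2)) \<le> 0"
  proof (cases n)
    \<comment> \<open>Here \<open>last\<close> is void; \<sigma> \<ge> 1/2 alone puts
      \<open>v\<close> at least as close to \<open>y 1\<close> as to \<open>y 0\<close>.\<close>
    case 0
    have "(1 - \<sigma>)\<^sup>2 \<le> \<sigma>\<^sup>2" using \<sigma> by (intro power_mono) auto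
    then have "((1 - \<sigma>) * d)\<^sup>2 \<le> (- \<sigma> * d)\<^sup>2"
      by (simp add: power_mult_distrib mult_right_mono)
    then have "(y 1 - v)\<^sup>2 - (y 0 - v)\<^sup>2 \<le> 0" using v1 v0 0 by simp
    then show ?thesis using pos 0 by (simp add: mult_nonneg_nonpos)
  next
    case (Suc m)
    have "0 \<le> (\<Sum>i\<in>{1..m}. (c (i + 1) - c i) * (y i - v)\<^sup>2)"
      using mono Suc by (intro sum_nonneg mult_nonneg_nonneg) auto
    \<comment> \<open>As \<sigma>^2 - (1 - \<sigma>)^2 = 2\<sigma> - 1, this says \<sigma>^2 c_n
      \<le> (2\<sigma> - 1) c_{n+1}, which follows from \<open>last\<close> and \<sigma> \<le>
      1.\<close>
    moreover have "c (n + 1) * (1 - \<sigma>)\<^sup>2 \<le> (c (n + 1) - c n) * \<sigma>\<^sup>2"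
    proof -
      have "c 1 \<le> c n"
        by (rule lift_Suc_mono_le_ivl[where N="{1..n}"]) (use mono Suc in auto)
      then have "0 \<le> c n" using pos by simp
      then have "\<sigma> * (\<sigma> * c n) \<le> \<sigma> * c n" using \<sigma>
        by (intro mult_left_le_one_le) auto
      then have "\<sigma>\<^sup>2 * c n \<le> (2 * \<sigma> - 1) * c (n + 1)"
        using last Suc by (simp add: power2_eq_square mult_ac)
      then show ?thesis by (simp add: algebra_simps power2_eq_square)
    qed
    then have "c (n + 1) * (1 - \<sigma>)\<^sup>2 * d\<^sup>2 \<le> (c (n + 1) - c n) * \<sigma>\<^sup>2 * d\<^sup>2"
      by (rule mult_right_mono) simp
    then have "c (n + 1) * (y (n + 1) - v)\<^sup>2 \<le> (c (n + 1) - c n) * (y n - v)\<^sup>2"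
      unfolding v1 v0 by (simp add: power_mult_distrib mult_ac)
    ultimately have "c (n + 1) * (y (n + 1) - v)\<^sup>2
        \<le> (\<Sum>i\<in>{1..n}. (c (i + 1) - c i) * (y i - v)\<^sup>2)"
      using Suc by simp
    moreover have "0 \<le> c 1 * (y 0 - v)\<^sup>2" using pos by simp
    ultimately show ?thesis
      using sum_by_parts[of c "\<lambda>i. (y i - v)\<^sup>2" n] by simp
  qed
  also have "(\<Sum>i\<in>{1..n+1}. c i * ((y i - v)\<^sup>2 - (y (i - 1) - v)\<^sup>2))
    = (\<Sum>i\<in>{1..n+1}. c i * ((y i)\<^sup>2 - (y (i - 1))\<^sup>2))
      - 2 * v * (\<Sum>i\<in>{1..n+1}. c i * (y i - y (i - 1)))"
    unfolding sum_distrib_left sum_subtractf[symmetric]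
    by (intro sum.cong) (auto simp: algebra_simps power2_eq_square)
  finally show ?thesis unfolding v_def[symmetric] by linarith
qed

lemma discrete_fractional_gronwall_step:
  fixes c E :: "nat \<Rightarrow> real"
  assumes pos: "0 < c 1" and mono: "\<And>i. 1 \<le> i \<Longrightarrow> i \<le> n \<Longrightarrow> c i \<le> c (i + 1)"
    and le: "(\<Sum>i\<in>{1..n+1}. c i * (E i - E (i - 1))) \<le> c 1 * B"
    and IH: "\<And>i. 1 \<le> i \<Longrightarrow> i \<le> n \<Longrightarrow> E i \<le> E 0 + B"
  shows "E (n + 1) \<le> E 0 + B"
proof -
  \<comment> \<open>Differences are unchanged by the shift, and \<open>?e 0 = - B\<close> makes the
    boundary term of the summation by parts cancel the right side \<open>c 1 * B\<close>.\<close>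
  let ?e = "\<lambda>i. E i - (E 0 + B)"
  have "c 1 \<le> c (n + 1)"
    by (rule lift_Suc_mono_le_ivl[where N="{1..n}"]) (use mono in auto)
  have "(\<Sum>i\<in>{1..n+1}. c i * (?e i - ?e (i - 1))) \<le> c 1 * B" using le by simp
  then have "c (n + 1) * ?e (n + 1) \<le> (\<Sum>i\<in>{1..n}. (c (i + 1) - c i) * ?e i)"
    using sum_by_parts[of c ?e n] by simp
  also have "\<dots> \<le> 0"
    using mono IH by (intro sum_nonpos mult_nonneg_nonpos) auto
  finally show ?thesis using pos \<open>c 1 \<le> c (n + 1)\<close>
    by (smt (verit) mult_pos_pos)
qed

section \<open>Coefficients of the time discretization\<close>

locale log_grid =
  fixes \<alpha> \<sigma> a \<tau> :: real
  assumes \<alpha>: "0 < \<alpha>" "\<alpha> < 1" and \<sigma>: "\<sigma> = 1 - \<alpha> / 2" and a: "0 < a" and \<tau>: "0 < \<tau>" "\<tau> \<le> a / 2"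
begin

section \<open>Geometry of the logarithmic grid\<close>

lemma \<sigma>_bounds: "0 < \<sigma>" "1 / 2 \<le> \<sigma>" "\<sigma> \<le> 1" "1 - \<alpha> \<le> \<sigma>"
  using \<alpha> \<sigma> by auto

text \<open>In the variable s = ln t this is the distance from the grid point s_i to the evaluation
  point s^*; it decreases in \<open>i\<close>.\<close>

definition gap :: "nat \<Rightarrow> nat \<Rightarrow> real" where
  "gap k i = ln (tg a \<tau> (real k + \<sigma>) / tg a \<tau> (real i))"

definition step :: "nat \<Rightarrow> real" where
  "step i = ln (tg a \<tau> (real i) / tg a \<tau> (real i - 1))"

text \<open>The derivative of \<open>-(s\<^sup>* - s)\<^bsup>1-\<alpha>\<^esup>\<close> at the logarithmic grid point \<open>s = ln t\<^sub>i\<close>.\<close>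
definition ker :: "nat \<Rightarrow> nat \<Rightarrow> real" where
  "ker k i = (1 - \<alpha>) * gap k i powr (- \<alpha>)"

lemma ker_nonneg: "0 \<le> ker k i"
  using \<alpha> by (simp add: ker_def)

lemma tg_pos: "0 \<le> s \<Longrightarrow> 0 < tg a \<tau> s"
  using a \<tau> by (simp add: tg_def add_pos_nonneg)

lemma tg_less: "r < s \<Longrightarrow> tg a \<tau> r < tg a \<tau> s"
  using \<tau> by (simp add: tg_def)

lemma gap_pos: "i \<le> k \<Longrightarrow> 0 < gap k i"
  unfolding gap_def using \<alpha> \<sigma>_bounds tg_pos[of "real i"] tg_less[of "real i" "real k + \<sigma>"]
  by (intro ln_gt_zero) simp

lemma step_pos: "1 \<le> i \<Longrightarrow> 0 < step i"
  unfolding step_def using tg_pos[of "real i - 1"] tg_less[of "real i - 1" "real i"]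
  by (intro ln_gt_zero) simp

lemma gap_diff: "1 \<le> i \<Longrightarrow> gap k (i - 1) - gap k i = step i"
  unfolding gap_def step_def
  using \<alpha> \<sigma>_bounds tg_pos[of "real i - 1"] tg_pos[of "real i"] tg_pos[of "real k + \<sigma>"]
  by (simp add: ln_div of_nat_diff)

text \<open>The bounds 1 - 1/x \<le> ln x \<le> x - 1 give \<open>step i\<close> at most \<tau> /
  t_{i-1} and \<open>step (i + 1)\<close> at least \<tau> / t_{i+1}.\<close>

lemma step_le_double:
  assumes "1 \<le> i"
  shows "step i \<le> 2 * step (i + 1)"
proof -
  define t where "t = tg a \<tau> (real i - 1)"
  have t: "a \<le> t" using assms \<tau> by (simp add: t_def tg_def)
  have ti: "tg a \<tau> (real i) = t + \<tau>" "tg a \<tau> (real (i + 1)) = t + 2 * \<tau>" "tg a \<tau> (real (i + 1) - 1) = t + \<tau>"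
    by (simp_all add: t_def tg_def algebra_simps)
  have "step i = ln (1 + \<tau> / t)"
    using t a by (simp add: step_def ti t_def[symmetric] field_simps)
  also have "\<dots> \<le> \<tau> / t"
    using t a \<tau> by (intro ln_add_one_self_le_self) simp
  \<comment> \<open>Equivalent to 2\<tau> \<le> t; this is where the smallness \<tau> \<le> a/2 of
    the time step enters, through t \<ge> a.\<close>
  also have "\<dots> \<le> 2 * (\<tau> / (t + 2 * \<tau>))"
    using t a \<tau> by (simp add: field_simps)
  also have "\<tau> / (t + 2 * \<tau>) = 1 - (t + \<tau>) / (t + 2 * \<tau>)"
    using t a \<tau> by (simp add: field_simps)
  also have "\<dots> \<le> - ln ((t + \<tau>) / (t + 2 * \<tau>))"
    using ln_le_minus_one[of "(t + \<tau>) / (t + 2 * \<tau>)"] t a \<tau> by simp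
  also have "\<dots> = step (i + 1)"
    using t a \<tau> by (simp only: step_def ti) (simp add: ln_div)
  finally show ?thesis by simp
qed

lemma sigma_step_le_gap: "\<sigma> * step (k + 1) \<le> gap k k"
proof -
  have "concave_on {0<..} (ln :: real \<Rightarrow> real)" by (rule ln_concave)
  then have "(1 - \<sigma>) * ln (tg a \<tau> (real k)) + \<sigma> * ln (tg a \<tau> (real k + 1))
      \<le> ln ((1 - \<sigma>) *\<^sub>R tg a \<tau> (real k) + \<sigma> *\<^sub>R tg a \<tau> (real k + 1))"
    using \<alpha> \<sigma>_bounds tg_pos by (intro concave_onD) auto
  also have "(1 - \<sigma>) *\<^sub>R tg a \<tau> (real k) + \<sigma> *\<^sub>R tg a \<tau> (real k + 1) = tg a \<tau> (real k + \<sigma>)"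
    by (simp add: tg_def algebra_simps)
  finally have "\<sigma> * (ln (tg a \<tau> (real k + 1)) - ln (tg a \<tau> (real k)))
      \<le> ln (tg a \<tau> (real k + \<sigma>)) - ln (tg a \<tau> (real k))"
    by (simp add: algebra_simps)
  then show ?thesis
    using \<alpha> \<sigma>_bounds tg_pos[of "real k"] tg_pos[of "real k + 1"] tg_pos[of "real k + \<sigma>"]
    by (simp add: gap_def step_def ln_div add.commute)
qed

section \<open>Bounds and monotonicity of the coefficients\<close>

lemma acf_eq:
  "1 \<le> i \<Longrightarrow> acf \<alpha> \<sigma> a \<tau> i k = gap k (i - 1) powr (1 - \<alpha>) - gap k i powr (1 - \<alpha>)"
  by (simp add: acf_def gap_def of_nat_diff)

lemma bcf_eq:
  assumes "1 \<le> i"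
  shows "bcf \<alpha> \<sigma> a \<tau> i k = trap \<alpha> (gap k i) (gap k (i - 1)) / (step i + step (i + 1))"
proof -
  have "ln (tg a \<tau> (real i + 1) / tg a \<tau> (real i - 1)) = step i + step (i + 1)"
    using assms tg_pos[of "real i - 1"] tg_pos[of "real i"] tg_pos[of "real i + 1"]
    by (simp add: step_def ln_div add.commute)
  then show ?thesis
    using assms gap_diff[OF assms, of k]
    by (simp add: bcf_def trap_def gap_def step_def of_nat_diff)
qed

lemma bcf_nonneg:
  assumes "1 \<le> i" "i \<le> k"
  shows "0 \<le> bcf \<alpha> \<sigma> a \<tau> i k"
  unfolding bcf_eq[OF assms(1)]
  using \<alpha> assms gap_pos[of i k] gap_diff[of i k] step_pos[of i] step_pos[of "i + 1"]
  by (intro divide_nonneg_nonneg trap_nonneg) auto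

text \<open>Since \<open>trap\<close> is nonnegative, the denominator of b may be lowered to
  \<open>step i\<close>; \<open>trap_le_increment\<close> divided by \<open>step i\<close> is then
  exactly the claim.\<close>

lemma acf_minus_bcf_ge:
  assumes "1 \<le> i" "i \<le> k"
  shows "step i * ker k (i - 1) \<le> acf \<alpha> \<sigma> a \<tau> i k - bcf \<alpha> \<sigma> a \<tau> i k"
proof -
  let ?p = "gap k i" and ?q = "gap k (i - 1)" and ?d = "step i"
  have d: "0 < ?d" "0 < step (i + 1)" "?q - ?p = ?d" "0 < ?p"
    using assms step_pos gap_diff gap_pos by auto
  then have nn: "0 \<le> trap \<alpha> ?p ?q" using \<alpha> by (intro trap_nonneg) auto
  have "bcf \<alpha> \<sigma> a \<tau> i k \<le> trap \<alpha> ?p ?q / ?d"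
    unfolding bcf_eq[OF assms(1)] using d nn by (intro divide_left_mono) auto
  also have "\<dots> \<le> (?d * (?q powr (1 - \<alpha>) - ?p powr (1 - \<alpha>)) - ?d\<^sup>2 * ker k (i - 1)) / ?d"
    using trap_le_increment[of \<alpha> ?p ?q] \<alpha> d by (intro divide_right_mono) (auto simp: ker_def)
  also have "\<dots> = acf \<alpha> \<sigma> a \<tau> i k - ?d * ker k (i - 1)"
    using d assms by (simp add: acf_eq field_simps power2_eq_square)
  finally show ?thesis by simp
qed

lemma acf_le:
  assumes "1 \<le> i" "i \<le> k"
  shows "acf \<alpha> \<sigma> a \<tau> i k + \<alpha> * (1 - \<alpha>) * gap k (i - 1) powr (- \<alpha> - 1) * (step i)\<^sup>2 / 2
           \<le> step i * ker k i"
  using powr_secant_defect_ge[of \<alpha> "gap k i" "gap k (i - 1)"] assms \<alpha>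
    gap_pos[of i k] gap_diff[of i k] step_pos[of i]
  by (simp add: acf_eq ker_def)

text \<open>The bound is expressed by \<open>step (i + 1)\<close> so that, at index
  \<open>i - 1\<close>, it coincides with the surplus in \<open>acf_le\<close> at index
  \<open>i\<close>.\<close>

lemma bcf_le:
  assumes "1 \<le> i" "i \<le> k"
  shows "bcf \<alpha> \<sigma> a \<tau> i k \<le> \<alpha> * (1 - \<alpha>) * gap k i powr (- \<alpha> - 1) * (step (i + 1))\<^sup>2 / 2"
proof -
  let ?K = "\<alpha> * (1 - \<alpha>) * gap k i powr (- \<alpha> - 1)"
  let ?d = "step i" and ?e = "step (i + 1)"
  have d: "0 < ?d" "0 < ?e" "?d \<le> 2 * ?e"
    using assms step_pos step_le_double by auto
  \<comment> \<open>From d \<le> 2e: d^3 \<le> 4 d e^2 = 3 d e^2 + d e^2 \<le> 3 d e^2 + 2 e^3. The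
    factor 3 turns the 1/6 of \<open>trap_le\<close> into 1/2.\<close>
  have "?d * (?d * ?d) \<le> ?d * (4 * (?e * ?e))"
    using d mult_mono[of ?d "2 * ?e" ?d "2 * ?e"] by (intro mult_left_mono) auto
  moreover have "?d * (?e * ?e) \<le> 2 * ?e * (?e * ?e)"
    using d by (intro mult_right_mono) auto
  moreover have "0 < ?e * (?e * ?e)" using d by simp
  ultimately have cube: "?d ^ 3 \<le> 3 * ?e\<^sup>2 * (?d + ?e)"
    by (simp add: power2_eq_square power3_eq_cube algebra_simps)
  have "trap \<alpha> (gap k i) (gap k (i - 1)) \<le> ?K * ?d ^ 3 / 6"
    using trap_le[of \<alpha> "gap k i" "gap k (i - 1)"] assms \<alpha> gap_pos[of i k] gap_diff[of i k] d
    by simp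
  also have "\<dots> \<le> ?K * (3 * ?e\<^sup>2 * (?d + ?e)) / 6"
    using \<alpha> cube by (intro divide_right_mono mult_left_mono) auto
  finally show ?thesis
    unfolding bcf_eq[OF assms(1)] using d by (simp add: pos_divide_le_eq mult_ac)
qed

text \<open>The gain of the secant of \<open>x\<^bsup>1-\<alpha>\<^esup>\<close> over its tangent on one interval
  pays for the term \<open>b\<^sub>i\<^sub>-\<^sub>1\<^sub>,\<^sub>k\<close>; this uses that consecutive logarithmic steps differ at most by a factor 2.\<close>
lemma ccf_bounds:
  assumes "1 \<le> i" "i \<le> k"
  shows "ker k (i - 1) \<le> Gamma (2 - \<alpha>) * ccf \<alpha> \<sigma> a \<tau> i k"
    and "Gamma (2 - \<alpha>) * ccf \<alpha> \<sigma> a \<tau> i k \<le> ker k i"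
proof -
  \<comment> \<open>The convention b_{0,k} = 0 merges the first coefficient with the interior
    ones.\<close>
  define b' where "b' = (if i = 1 then 0 else bcf \<alpha> \<sigma> a \<tau> (i - 1) k)"
  have G: "0 < Gamma (2 - \<alpha>)" using \<alpha> by (intro Gamma_real_pos) simp
  have d: "0 < step i" using assms step_pos by simp
  have c: "Gamma (2 - \<alpha>) * ccf \<alpha> \<sigma> a \<tau> i k
             = (acf \<alpha> \<sigma> a \<tau> i k + b' - bcf \<alpha> \<sigma> a \<tau> i k) / step i"
    using assms G by (auto simp: ccf_def b'_def step_def)
  have "0 \<le> b'" using assms bcf_nonneg by (auto simp: b'_def)
  then show "ker k (i - 1) \<le> Gamma (2 - \<alpha>) * ccf \<alpha> \<sigma> a \<tau> i k"
    unfolding c using acf_minus_bcf_ge[OF assms] d by (simp add: pos_le_divide_eq mult.commute)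
  have "b' \<le> \<alpha> * (1 - \<alpha>) * gap k (i - 1) powr (- \<alpha> - 1) * (step i)\<^sup>2 / 2"
    using assms bcf_le[of "i - 1" k] \<alpha> by (auto simp: b'_def)
  then show "Gamma (2 - \<alpha>) * ccf \<alpha> \<sigma> a \<tau> i k \<le> ker k i"
    unfolding c using acf_le[OF assms] bcf_nonneg[OF assms] d
    by (simp add: pos_divide_le_eq mult.commute)
qed

text \<open>The b term is nonnegative and may be dropped; the rest is gap / step times gap powr
  (-\<alpha>), with gap / step \<ge> \<sigma>. The factor 1 - \<alpha> on the right is the one built
  into \<open>ker\<close>.\<close>

lemma ccf_last_ge: "\<sigma> * ker k k \<le> (1 - \<alpha>) * (Gamma (2 - \<alpha>) * ccf \<alpha> \<sigma> a \<tau> (k + 1) k)"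
proof -
  define b' where "b' = (if k = 0 then 0 else bcf \<alpha> \<sigma> a \<tau> k k)"
  have G: "0 < Gamma (2 - \<alpha>)" using \<alpha> by (intro Gamma_real_pos) simp
  have d: "0 < step (k + 1)" using step_pos by simp
  have A: "0 < gap k k" using gap_pos by simp
  have c: "Gamma (2 - \<alpha>) * ccf \<alpha> \<sigma> a \<tau> (k + 1) k
             = (b' + gap k k powr (1 - \<alpha>)) / step (k + 1)"
    using G by (auto simp: ccf_def b'_def step_def gap_def add.commute)
  have "0 \<le> b'" using bcf_nonneg by (auto simp: b'_def)
  have "\<sigma> * step (k + 1) * gap k k powr (- \<alpha>) \<le> gap k k * gap k k powr (- \<alpha>)"
    using sigma_step_le_gap by (intro mult_right_mono) auto
  also have "\<dots> = gap k k powr (1 - \<alpha>)"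
    using A by (simp add: powr_diff powr_minus divide_inverse)
  also have "\<dots> \<le> b' + gap k k powr (1 - \<alpha>)" using \<open>0 \<le> b'\<close> by simp
  finally have "\<sigma> * gap k k powr (- \<alpha>) \<le> Gamma (2 - \<alpha>) * ccf \<alpha> \<sigma> a \<tau> (k + 1) k"
    unfolding c using d by (simp add: pos_le_divide_eq mult_ac)
  then have "(1 - \<alpha>) * (\<sigma> * gap k k powr (- \<alpha>)) \<le> (1 - \<alpha>) * (Gamma (2 - \<alpha>) * ccf \<alpha> \<sigma> a \<tau> (k + 1) k)"
    using \<alpha> by (intro mult_left_mono) auto
  then show ?thesis by (simp add: ker_def mult_ac)
qed

text \<open>For \<sigma> = 1 - \<alpha>/2 the factor 2\<sigma> - 1 equals the 1 - \<alpha> of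
  \<open>ccf_last_ge\<close>. This supplies \<open>last\<close> in
  \<open>weighted_average_energy\<close>.\<close>

lemma ccf_last_weighted:
  assumes "1 \<le> k"
  shows "\<sigma> * ccf \<alpha> \<sigma> a \<tau> k k \<le> (2 * \<sigma> - 1) * ccf \<alpha> \<sigma> a \<tau> (k + 1) k"
proof -
  have G: "0 < Gamma (2 - \<alpha>)" using \<alpha> by (intro Gamma_real_pos) simp
  have "\<sigma> * (Gamma (2 - \<alpha>) * ccf \<alpha> \<sigma> a \<tau> k k) \<le> \<sigma> * ker k k"
    using ccf_bounds(2)[of k k] assms \<alpha> \<sigma>_bounds by (intro mult_left_mono) auto
  also note ccf_last_ge[of k]
  finally have "Gamma (2 - \<alpha>) * (\<sigma> * ccf \<alpha> \<sigma> a \<tau> k k)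
      \<le> Gamma (2 - \<alpha>) * ((1 - \<alpha>) * ccf \<alpha> \<sigma> a \<tau> (k + 1) k)"
    by (simp add: mult_ac)
  then show ?thesis using G \<sigma> by simp
qed

text \<open>The value \<open>ker k i\<close>, scaled by Gamma (2 - \<alpha>), separates the two
  neighbours. For the last pair the separation comes from \<open>ccf_last_ge\<close> and 1 -
  \<alpha> \<le> \<sigma>.\<close>

lemma ccf_mono:
  assumes "1 \<le> i" "i \<le> k"
  shows "ccf \<alpha> \<sigma> a \<tau> i k \<le> ccf \<alpha> \<sigma> a \<tau> (i + 1) k"
proof -
  have G: "0 < Gamma (2 - \<alpha>)" using \<alpha> by (intro Gamma_real_pos) simp
  have "ker k i \<le> Gamma (2 - \<alpha>) * ccf \<alpha> \<sigma> a \<tau> (i + 1) k"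
  proof (cases "i = k")
    case True
    have "(1 - \<alpha>) * ker k k \<le> \<sigma> * ker k k"
      using \<alpha> \<sigma>_bounds by (intro mult_right_mono) (auto simp: ker_nonneg)
    also note ccf_last_ge[of k]
    finally show ?thesis using True \<alpha> by simp
  next
    case False
    then show ?thesis using ccf_bounds(1)[of "i + 1" k] assms by simp
  qed
  with ccf_bounds(2)[OF assms] have "Gamma (2 - \<alpha>) * ccf \<alpha> \<sigma> a \<tau> i k \<le> Gamma (2 - \<alpha>) * ccf \<alpha> \<sigma> a \<tau> (i + 1) k"
    by linarith
  then show ?thesis using G by simp
qed

text \<open>The lower bound \<open>ker k 0\<close> and ln (1 + x/a) \<le> x/a with x = (k +
  \<sigma>)\<tau> produce the weight and the factor a powr \<alpha> of the stability
  estimate.\<close>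

lemma ccf_first_ge:
  "a powr \<alpha> \<le> Gamma (1 - \<alpha>) * ((real k + \<sigma>) * \<tau>) powr \<alpha> * ccf \<alpha> \<sigma> a \<tau> 1 k"
proof -
  have G: "0 < Gamma (1 - \<alpha>)" using \<alpha> by (intro Gamma_real_pos) simp
  have G2: "Gamma (2 - \<alpha>) = (1 - \<alpha>) * Gamma (1 - \<alpha>)"
    using Gamma_plus1[of "1 - \<alpha>"] \<alpha> nonpos_Ints_nonpos[of "1 - \<alpha>"] by (auto simp: algebra_simps)
  have "ker k 0 \<le> Gamma (2 - \<alpha>) * ccf \<alpha> \<sigma> a \<tau> 1 k"
  proof (cases "k = 0")
    case True
    have "(1 - \<alpha>) * ker 0 0 \<le> \<sigma> * ker 0 0"
      using \<alpha> \<sigma>_bounds by (intro mult_right_mono) (auto simp: ker_nonneg)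
    also note ccf_last_ge[of 0]
    finally show ?thesis using True \<alpha> by simp
  next
    case False
    then show ?thesis using ccf_bounds(1)[of 1 k] by simp
  qed
  then have 1: "gap k 0 powr (- \<alpha>) \<le> Gamma (1 - \<alpha>) * ccf \<alpha> \<sigma> a \<tau> 1 k"
    using \<alpha> by (simp add: G2 ker_def mult.assoc)
  let ?x = "(real k + \<sigma>) * \<tau>"
  have x: "0 < ?x" using \<alpha> \<sigma>_bounds \<tau> by simp
  have "gap k 0 = ln (1 + ?x / a)" using a by (simp add: gap_def tg_def field_simps)
  also have "\<dots> \<le> ?x / a" using x a by (intro ln_add_one_self_le_self) simp
  finally have "(?x / a) powr (- \<alpha>) \<le> gap k 0 powr (- \<alpha>)"
    using gap_pos[of 0 k] \<alpha> by (intro powr_mono2') auto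
  with 1 have "(?x / a) powr (- \<alpha>) \<le> Gamma (1 - \<alpha>) * ccf \<alpha> \<sigma> a \<tau> 1 k" by linarith
  then have "?x powr \<alpha> * (?x / a) powr (- \<alpha>) \<le> ?x powr \<alpha> * (Gamma (1 - \<alpha>) * ccf \<alpha> \<sigma> a \<tau> 1 k)"
    by (rule mult_left_mono) simp
  moreover have "y powr \<alpha> * (y / a) powr (- \<alpha>) = a powr \<alpha>" if "0 < y" for y
    using that a by (simp add: powr_minus powr_divide)
  from this[OF x] have "?x powr \<alpha> * (?x / a) powr (- \<alpha>) = a powr \<alpha>" .
  ultimately show ?thesis by (simp only: mult_ac)
qed

lemma ccf_first_pos: "0 < ccf \<alpha> \<sigma> a \<tau> 1 k"
proof -
  have "0 < a powr \<alpha>" using a by simp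
  also note ccf_first_ge[of k]
  finally have "0 < Gamma (1 - \<alpha>) * ((real k + \<sigma>) * \<tau>) powr \<alpha> * ccf \<alpha> \<sigma> a \<tau> 1 k" .
  moreover have "0 \<le> Gamma (1 - \<alpha>) * ((real k + \<sigma>) * \<tau>) powr \<alpha>"
    using \<alpha> Gamma_real_pos[of "1 - \<alpha>"] by simp
  ultimately show ?thesis by (meson mult_nonneg_nonpos not_less)
qed

end

section \<open>Coercivity of the discrete fractional Laplacian\<close>

lemma integral_cos_shift:
  fixes m :: int and c :: real
  shows "integral {-pi..pi} (\<lambda>x. cos (c + x * real_of_int m)) = (if m = 0 then 2 * pi * cos c else 0)"
proof (cases "m = 0")
  case False
  let ?F = "\<lambda>x. sin (c + x * real_of_int m) / real_of_int m"
  have "((\<lambda>x. cos (c + x * real_of_int m)) has_integral (?F pi - ?F (- pi))) {-pi..pi}"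
    using False by (intro fundamental_theorem_of_calculus)
      (auto intro!: derivative_eq_intros simp: has_real_derivative_iff_has_vector_derivative[symmetric])
  moreover have "sin (c + pi * real_of_int m) = sin (c - pi * real_of_int m)"
    by (simp add: sin_add sin_diff)
  ultimately show ?thesis using False by (simp add: integral_unique)
qed simp

abbreviation torus :: "(real \<times> real) set" where
  "torus \<equiv> cbox (-pi, -pi) (pi, pi)"

definition phase :: "int \<times> int \<Rightarrow> real \<times> real \<Rightarrow> real" where
  "phase x \<eta> = fst \<eta> * real_of_int (fst x) + snd \<eta> * real_of_int (snd x)"

lemma phase_diff: "phase (x - y) \<eta> = phase x \<eta> - phase y \<eta>"
  by (simp add: phase_def algebra_simps)

lemma continuous_on_phase [continuous_intros]: "continuous_on S (phase x)"
  unfolding phase_def by (intro continuous_intros)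

lemma integral_cos_phase:
  "integral torus (\<lambda>\<eta>. cos (phase x \<eta>)) = (if x = 0 then 4 * pi\<^sup>2 else 0)"
proof -
  have "integral torus (\<lambda>\<eta>. cos (phase x \<eta>))
      = integral {-pi..pi} (\<lambda>u. integral {-pi..pi} (\<lambda>v. cos (u * real_of_int (fst x) + v * real_of_int (snd x))))"
    by (subst integral_prod_continuous) (auto intro!: continuous_intros simp: phase_def)
  also have "\<dots> = integral {-pi..pi} (\<lambda>u. if snd x = 0 then 2 * pi * cos (0 + u * real_of_int (fst x)) else 0)"
    by (cases "snd x = 0") (simp_all add: integral_cos_shift)
  also have "\<dots> = (if x = 0 then 4 * pi\<^sup>2 else 0)"
    using integral_cos_shift[of 0 "fst x"]
    by (cases "snd x = 0") (auto simp: prod_eq_iff power2_eq_square)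
  finally show ?thesis .
qed

text \<open>The Fourier symbol of the difference operator without its factor h powr
  (-\<beta>).\<close>

definition lapsym :: "real \<Rightarrow> real \<times> real \<Rightarrow> real" where
  "lapsym \<beta> \<eta> = (4 * (sin (fst \<eta> / 2))\<^sup>2 + 4 * (sin (snd \<eta> / 2))\<^sup>2) powr (\<beta> / 2)"

lemma continuous_on_lapsym [continuous_intros]:
  "0 < \<beta> \<Longrightarrow> continuous_on S (lapsym \<beta>)"
  unfolding lapsym_def by (intro continuous_on_powr' continuous_intros) auto

lemma Re_fcoef:
  assumes "0 < \<beta>"
  shows "Re (fcoef \<beta> l m) = 1 / (4 * pi\<^sup>2) * integral torus (\<lambda>\<eta>. lapsym \<beta> \<eta> * cos (phase (l, m) \<eta>))"
proof -
  let ?f = "\<lambda>\<eta>. complex_of_real (lapsym \<beta> \<eta>) * exp (- \<i> * complex_of_real (phase (l, m) \<eta>))"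
  have "fcoef \<beta> l m = complex_of_real (1 / (4 * pi\<^sup>2)) * integral torus ?f"
    by (simp add: fcoef_def lapsym_def phase_def case_prod_beta')
  then have "Re (fcoef \<beta> l m) = 1 / (4 * pi\<^sup>2) * Re (integral torus ?f)"
    by (simp only: times_complex.sel Re_complex_of_real Im_complex_of_real mult_zero_left diff_zero)
  also have "?f integrable_on torus"
    using assms by (intro integrable_continuous continuous_intros)
  then have "Re (integral torus ?f) = integral torus (Re \<circ> ?f)"
    by (simp add: integral_linear bounded_linear_Re)
  also have "Re \<circ> ?f = (\<lambda>\<eta>. lapsym \<beta> \<eta> * cos (phase (l, m) \<eta>))"
    by (auto simp: fun_eq_iff Re_exp)
  finally show ?thesis .
qed

definition idx :: "nat \<Rightarrow> (int \<times> int) set" where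
  "idx M = {1..int M - 1} \<times> {1..int M - 1}"

lemma finite_idx [simp]: "finite (idx M)"
  by (simp add: idx_def)

text \<open>Only offsets that lead from (j, k) into the interior contribute, because
  \<open>gext\<close> vanishes elsewhere; the sum is reindexed by the point reached.\<close>

lemma fraclap_finite:
  "fraclap \<beta> h M w j k = complex_of_real (h powr (- \<beta>)) *
     (\<Sum>(p, q)\<in>idx M. fcoef \<beta> (p - j) (q - k) * complex_of_real (w p q))"
proof -
  let ?f = "\<lambda>(l, m). fcoef \<beta> l m * complex_of_real (gext M w (j + l) (k + m))"
  let ?s = "\<lambda>(p, q). (p - j, q - k)"
  have "?f x = 0" if "x \<notin> ?s ` idx M" for x
  proof -
    obtain l m where x: "x = (l, m)" by force
    have "(j + l, k + m) \<notin> idx M"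
      using that by (force simp: x image_iff)
    then show ?thesis by (auto simp: x gext_def idx_def)
  qed
  then have "infsum ?f UNIV = infsum ?f (?s ` idx M)"
    by (intro infsum_cong_neutral) auto
  also have "\<dots> = sum ?f (?s ` idx M)" by simp
  also have "\<dots> = (\<Sum>x\<in>idx M. ?f (?s x))"
    by (subst sum.reindex) (auto simp: inj_on_def)
  also have "\<dots> = (\<Sum>(p, q)\<in>idx M. fcoef \<beta> (p - j) (q - k) * complex_of_real (w p q))"
    by (intro sum.cong) (auto simp: gext_def idx_def)
  finally show ?thesis by (simp add: fraclap_def)
qed

text \<open>The squared modulus of the discrete Fourier transform of \<open>w\<close>, written in
  real form.\<close>

definition spectral_density :: "(int \<times> int) set \<Rightarrow> (int \<times> int \<Rightarrow> real) \<Rightarrow> real \<times> real \<Rightarrow> real" where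
  "spectral_density I w \<eta> = (\<Sum>x\<in>I. w x * cos (phase x \<eta>))\<^sup>2 + (\<Sum>x\<in>I. w x * sin (phase x \<eta>))\<^sup>2"

lemma spectral_density_nonneg: "0 \<le> spectral_density I w \<eta>"
  by (simp add: spectral_density_def)

lemma continuous_on_spectral_density [continuous_intros]:
  "continuous_on S (spectral_density I w)"
  unfolding spectral_density_def by (intro continuous_intros)

lemma spectral_density_expand:
  "spectral_density I w \<eta> = (\<Sum>x\<in>I. \<Sum>y\<in>I. w x * w y * cos (phase (y - x) \<eta>))"
  unfolding spectral_density_def power2_eq_square sum_product sum.distrib[symmetric]
  by (intro sum.cong refl) (simp add: phase_diff cos_diff algebra_simps)

text \<open>Taking \<phi> = 1 gives Parseval's identity, taking \<phi> =
  \<open>lapsym \<beta>\<close> the quadratic form of the operator.\<close>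

lemma integral_mult_spectral_density:
  assumes "finite I" "continuous_on torus \<phi>"
  shows "integral torus (\<lambda>\<eta>. \<phi> \<eta> * spectral_density I w \<eta>)
    = (\<Sum>x\<in>I. \<Sum>y\<in>I. w x * w y * integral torus (\<lambda>\<eta>. \<phi> \<eta> * cos (phase (y - x) \<eta>)))"
proof -
  have int: "(\<lambda>\<eta>. w x * w y * (\<phi> \<eta> * cos (phase (y - x) \<eta>))) integrable_on torus" for x y
    using assms by (intro integrable_continuous continuous_intros)
  have "integral torus (\<lambda>\<eta>. \<phi> \<eta> * spectral_density I w \<eta>)
      = integral torus (\<lambda>\<eta>. \<Sum>x\<in>I. \<Sum>y\<in>I. w x * w y * (\<phi> \<eta> * cos (phase (y - x) \<eta>)))"
    by (simp add: spectral_density_expand sum_distrib_left mult_ac)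
  also have "\<dots> = (\<Sum>x\<in>I. \<Sum>y\<in>I. integral torus (\<lambda>\<eta>. w x * w y * (\<phi> \<eta> * cos (phase (y - x) \<eta>))))"
    using assms(1) int by (simp add: integral_sum integrable_sum)
  finally show ?thesis by simp
qed

lemma parseval:
  assumes "finite I"
  shows "integral torus (spectral_density I w) = 4 * pi\<^sup>2 * (\<Sum>x\<in>I. (w x)\<^sup>2)"
proof -
  have "integral torus (spectral_density I w)
      = (\<Sum>x\<in>I. \<Sum>y\<in>I. w x * w y * (if y - x = 0 then 4 * pi\<^sup>2 else 0))"
    using integral_mult_spectral_density[OF assms continuous_on_const, of 1 w]
    by (simp add: integral_cos_phase)
  also have "\<dots> = (\<Sum>x\<in>I. \<Sum>y\<in>I. if y = x then w x * w y * (4 * pi\<^sup>2) else 0)"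
    by (intro sum.cong refl) simp
  also have "\<dots> = 4 * pi\<^sup>2 * (\<Sum>x\<in>I. (w x)\<^sup>2)"
    using assms by (simp add: sum.delta sum_distrib_left power2_eq_square mult_ac)
  finally show ?thesis .
qed

text \<open>Cauchy-Schwarz for the cosine and the sine sum; at each point the squares of cosine and
  sine add up to 1.\<close>

lemma spectral_density_le:
  "spectral_density I w \<eta> \<le> real (card I) * (\<Sum>x\<in>I. (w x)\<^sup>2)"
proof -
  have "spectral_density I w \<eta> \<le> (\<Sum>x\<in>I. (w x)\<^sup>2) * (\<Sum>x\<in>I. (cos (phase x \<eta>))\<^sup>2)
      + (\<Sum>x\<in>I. (w x)\<^sup>2) * (\<Sum>x\<in>I. (sin (phase x \<eta>))\<^sup>2)"
    unfolding spectral_density_def by (intro add_mono Cauchy_Schwarz_ineq_sum)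
  also have "\<dots> = (\<Sum>x\<in>I. (w x)\<^sup>2) * (\<Sum>x\<in>I. (cos (phase x \<eta>))\<^sup>2 + (sin (phase x \<eta>))\<^sup>2)"
    by (simp only: sum.distrib distrib_left)
  finally show ?thesis by (simp add: mult.commute)
qed

lemma fraclap_form:
  assumes "0 < \<beta>"
  shows "(\<Sum>(j, k)\<in>idx M. w j k * Re (fraclap \<beta> h M w j k))
    = h powr (- \<beta>) / (4 * pi\<^sup>2) * integral torus (\<lambda>\<eta>. lapsym \<beta> \<eta> * spectral_density (idx M) (\<lambda>(j, k). w j k) \<eta>)"
  using assms
  by (subst integral_mult_spectral_density)
    (auto intro!: continuous_intros sum.cong simp: fraclap_finite Re_fcoef sum_distrib_left case_prod_beta
      minus_prod_def)

section \<open>Lower bounds for the symbol and the quadratic form\<close>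

lemma jordan_sin:
  fixes x :: real
  assumes "0 \<le> x" "x \<le> pi / 2"
  shows "2 * x / pi \<le> sin x"
proof -
  have "concave_on {0..pi / 2} (sin :: real \<Rightarrow> real)"
    by (rule f''_le0_imp_concave[where f' = cos and f'' = "\<lambda>x. - sin x"])
      (auto intro!: derivative_eq_intros sin_ge_zero)
  then have "(1 - 2 * x / pi) * sin 0 + 2 * x / pi * sin (pi / 2)
      \<le> sin ((1 - 2 * x / pi) *\<^sub>R 0 + (2 * x / pi) *\<^sub>R (pi / 2))"
    using assms by (intro concave_onD) (auto simp: field_simps)
  then show ?thesis by simp
qed

lemma sin_half_square_ge:
  fixes x :: real
  assumes "\<bar>x\<bar> \<le> pi"
  shows "(x / pi)\<^sup>2 \<le> (sin (x / 2))\<^sup>2"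
proof -
  have "\<bar>x\<bar> / pi \<le> sin (\<bar>x\<bar> / 2)" using jordan_sin[of "\<bar>x\<bar> / 2"] assms by simp
  then have "(\<bar>x\<bar> / pi)\<^sup>2 \<le> (sin (\<bar>x\<bar> / 2))\<^sup>2" by (intro power_mono) auto
  also have "(sin (\<bar>x\<bar> / 2))\<^sup>2 = (sin (x / 2))\<^sup>2" by (simp add: abs_if)
  finally show ?thesis by (simp add: power_divide)
qed

lemma lapsym_ge:
  assumes "0 < \<beta>" "0 \<le> e" "\<eta> \<in> torus" "\<eta> \<notin> cbox (- (pi * e), - (pi * e)) (pi * e, pi * e)"
  shows "(2 * e) powr \<beta> \<le> lapsym \<beta> \<eta>"
proof -
  obtain u v where \<eta>: "\<eta> = (u, v)" by force
  have uv: "\<bar>u\<bar> \<le> pi" "\<bar>v\<bar> \<le> pi" using assms(3) by (auto simp: \<eta> cbox_Pair_eq)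
  have big: "e\<^sup>2 \<le> (sin (x / 2))\<^sup>2" if "\<bar>x\<bar> \<le> pi" "pi * e < \<bar>x\<bar>" for x
  proof -
    have "e \<le> \<bar>x\<bar> / pi" using that by (simp add: field_simps)
    then have "e\<^sup>2 \<le> (\<bar>x\<bar> / pi)\<^sup>2" using assms by (intro power_mono) auto
    then show ?thesis using sin_half_square_ge[OF that(1)] by (simp add: power_divide)
  qed
  have "pi * e < \<bar>u\<bar> \<or> pi * e < \<bar>v\<bar>"
    using assms(4) by (auto simp: \<eta> cbox_Pair_eq)
  then have "(2 * e)\<^sup>2 \<le> 4 * (sin (u / 2))\<^sup>2 + 4 * (sin (v / 2))\<^sup>2"
    using big[of u] big[of v] uv by (auto simp: power_mult_distrib add_increasing add_increasing2)
  then have "((2 * e)\<^sup>2) powr (\<beta> / 2) \<le> lapsym \<beta> \<eta>"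
    unfolding lapsym_def \<eta> using assms by (intro powr_mono2) auto
  moreover have "((2 * e)\<^sup>2) powr (\<beta> / 2) = (2 * e) powr \<beta>"
    using assms powr_powr[of "2 * e" 2 "\<beta> / 2"] by (cases "e = 0") auto
  ultimately show ?thesis by simp
qed

text \<open>A grid function supported on \<open>(M-1)\<^sup>2\<close> points has spectral density at most \<open>M\<^sup>2\<close> times its
  squared norm, so at most a quarter of its spectral mass lies in the square \<open>\<bar>\<eta>\<^sub>i\<bar> \<le> \<pi>/(2M)\<close>;
  elsewhere the symbol is at least \<open>M\<^bsup>-\<beta>\<^esup>\<close>.\<close>
lemma fraclap_coercive:
  assumes "0 < \<beta>" "0 < L" "0 < M" "h = 2 * L / real M"
  shows "3 / 4 * (2 * L) powr (- \<beta>) * (\<Sum>(j, k)\<in>idx M. (w j k)\<^sup>2)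
    \<le> (\<Sum>(j, k)\<in>idx M. w j k * Re (fraclap \<beta> h M w j k))"
proof -
  define I where "I = idx M"
  define W where "W = (\<lambda>(j, k). w j k)"
  define E where "E = (\<Sum>x\<in>I. (W x)\<^sup>2)"
  \<comment> \<open>The square \<open>Q\<close> then has area (pi/M)^2, so its spectral mass is at
    most pi^2 E out of 4 pi^2 E, and (2e) powr \<beta> is \<open>m\<close>.\<close>
  define e where "e = 1 / (2 * real M)"
  define Q where "Q = cbox (- (pi * e), - (pi * e)) (pi * e, pi * e)"
  define m where "m = real M powr (- \<beta>)"
  let ?P = "spectral_density I W"
  have e: "0 < e" "e \<le> 1" using assms by (auto simp: e_def)
  then have Q: "Q \<subseteq> torus" by (simp add: Q_def cbox_Pair_eq times_subset_iff)
  have E: "0 \<le> E" by (auto simp: E_def sum_nonneg)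
  have "nat (int M - 1) = M - 1" by linarith
  then have "card I = (M - 1) * (M - 1)" by (simp add: I_def idx_def card_cartesian_product)
  also have "\<dots> \<le> M * M" by (intro mult_mono) auto
  finally have card: "real (card I) \<le> (real M)\<^sup>2" by (simp add: power2_eq_square flip: of_nat_mult)
  have intP: "?P integrable_on cbox c d" for c d
    by (intro integrable_continuous continuous_intros)
  have "integral Q ?P \<le> integral Q (\<lambda>_. (real M)\<^sup>2 * E)"
    unfolding Q_def
    by (intro integral_le intP integrable_const)
       (use card E in \<open>auto intro!: order_trans[OF spectral_density_le] mult_right_mono simp: E_def\<close>)
  also have "\<dots> = (2 * (pi * e))\<^sup>2 * ((real M)\<^sup>2 * E)"
    using e by (simp add: Q_def content_Pair power2_eq_square)
  also have "\<dots> = pi\<^sup>2 * E"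
    using assms by (simp add: e_def power2_eq_square)
  finally have small: "integral Q ?P \<le> pi\<^sup>2 * E" .
  \<comment> \<open>Cutting the density off outside \<open>Q\<close> turns the integral over
    \<open>Q\<close> into one over the torus, so that integrands can be compared pointwise.\<close>
  have restr: "((\<lambda>\<eta>. if \<eta> \<in> Q then ?P \<eta> else 0) has_integral integral Q ?P) torus"
    using Q unfolding Q_def
    by (intro has_integral_restrict_closed_subinterval integrable_integral intP)
  have "m * (3 * pi\<^sup>2 * E) \<le> m * (4 * pi\<^sup>2 * E - integral Q ?P)"
    using small by (intro mult_left_mono) (auto simp: m_def mult.commute)
  also have "4 * pi\<^sup>2 * E = integral torus ?P"
    by (simp add: parseval E_def I_def)
  also have "m * (integral torus ?P - integral Q ?P)
      = integral torus (\<lambda>\<eta>. m * (?P \<eta> - (if \<eta> \<in> Q then ?P \<eta> else 0)))"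
    using restr intP by (simp add: integral_diff has_integral_iff)
  also have "\<dots> \<le> integral torus (\<lambda>\<eta>. lapsym \<beta> \<eta> * ?P \<eta>)"
  proof (rule integral_le)
    show "(\<lambda>\<eta>. m * (?P \<eta> - (if \<eta> \<in> Q then ?P \<eta> else 0))) integrable_on torus"
      by (rule integrable_on_mult_right, rule integrable_diff[OF intP has_integral_integrable[OF restr]])
    show "(\<lambda>\<eta>. lapsym \<beta> \<eta> * ?P \<eta>) integrable_on torus"
      using assms by (intro integrable_continuous continuous_intros)
    fix \<eta> assume \<eta>: "\<eta> \<in> torus"
    show "m * (?P \<eta> - (if \<eta> \<in> Q then ?P \<eta> else 0)) \<le> lapsym \<beta> \<eta> * ?P \<eta>"
    proof (cases "\<eta> \<in> Q")
      case True
      then show ?thesis by (simp add: spectral_density_nonneg lapsym_def)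
    next
      case False
      have "m = (2 * e) powr \<beta>"
        using assms by (simp add: m_def e_def powr_minus_divide powr_divide)
      also have "\<dots> \<le> lapsym \<beta> \<eta>"
        using lapsym_ge[OF assms(1) _ \<eta>] e False by (simp add: Q_def)
      finally show ?thesis using False by (simp add: spectral_density_nonneg mult_right_mono)
    qed
  qed
  finally have "h powr (- \<beta>) / (4 * pi\<^sup>2) * (m * (3 * pi\<^sup>2 * E))
      \<le> h powr (- \<beta>) / (4 * pi\<^sup>2) * integral torus (\<lambda>\<eta>. lapsym \<beta> \<eta> * ?P \<eta>)"
    by (rule mult_left_mono) simp
  also have "\<dots> = (\<Sum>(j, k)\<in>idx M. w j k * Re (fraclap \<beta> h M w j k))"
    using assms by (simp add: fraclap_form I_def W_def)
  also have "h powr (- \<beta>) / (4 * pi\<^sup>2) * (m * (3 * pi\<^sup>2 * E)) = 3 / 4 * (h powr (- \<beta>) * m) * E"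
    by simp
  \<comment> \<open>Since h M = 2L, the dependence on M cancels and the constant is uniform in
    h.\<close>
  also have "h powr (- \<beta>) * m = (2 * L) powr (- \<beta>)"
    using assms by (simp add: m_def powr_divide)
  finally show ?thesis by (simp add: E_def I_def W_def case_prod_beta)
qed

section \<open>Stability\<close>

lemma gnorm2_eq: "gnorm2 h M w = h\<^sup>2 * (\<Sum>(j, k)\<in>idx M. (w j k)\<^sup>2)"
  by (simp add: gnorm2_def idx_def sum.cartesian_product)

lemma gnorm2_nonneg: "0 \<le> gnorm2 h M w"
  unfolding gnorm2_def by (intro mult_nonneg_nonneg sum_nonneg) auto

text \<open>The scheme is multiplied by the weighted average \<open>v\<close> at every interior
  point and summed: the time part is bounded below pointwise, the space part by coercivity.\<close>

lemma (in log_grid) scheme_energy_estimate: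
  fixes U :: "nat \<Rightarrow> int \<Rightarrow> int \<Rightarrow> real" and f :: "int \<Rightarrow> int \<Rightarrow> real"
  assumes "0 < \<beta>" "0 < L" "0 < M" "h = 2 * L / real M"
    and scheme: "\<And>j k. (j, k) \<in> idx M \<Longrightarrow>
      complex_of_real (\<Sum>i\<in>{1..n+1}. ccf \<alpha> \<sigma> a \<tau> i n * (U i j k - U (i - 1) j k))
        + fraclap \<beta> h M (\<lambda>p q. \<sigma> * U (n + 1) p q + (1 - \<sigma>) * U n p q) j k
      = complex_of_real (f j k)"
  shows "(\<Sum>i\<in>{1..n+1}. ccf \<alpha> \<sigma> a \<tau> i n * (gnorm2 h M (U i) - gnorm2 h M (U (i - 1))))
    \<le> gnorm2 h M f / (2 * (3 / 4 * (2 * L) powr (- \<beta>)))"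
proof -
  define lam where "lam = 3 / 4 * (2 * L) powr (- \<beta>)"
  have lam: "0 < lam" using assms by (simp add: lam_def)
  define c where "c = (\<lambda>i. ccf \<alpha> \<sigma> a \<tau> i n)"
  define v where "v = (\<lambda>p q. \<sigma> * U (n + 1) p q + (1 - \<sigma>) * U n p q)"
  define E where "E = (\<lambda>w :: int \<Rightarrow> int \<Rightarrow> real. \<Sum>(j, k)\<in>idx M. (w j k)\<^sup>2)"
  have E: "gnorm2 h M w = h\<^sup>2 * E w" for w by (simp add: gnorm2_eq E_def)
  have "(\<Sum>i\<in>{1..n+1}. c i * (E (U i) - E (U (i - 1)))) / 2
      = (\<Sum>(j, k)\<in>idx M. (\<Sum>i\<in>{1..n+1}. c i * ((U i j k)\<^sup>2 - (U (i - 1) j k)\<^sup>2)) / 2)"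
    unfolding E_def case_prod_beta sum_subtractf[symmetric] sum_distrib_left sum_divide_distrib
    by (rule sum.swap)
  also have "\<dots> \<le> (\<Sum>(j, k)\<in>idx M. v j k * f j k - v j k * Re (fraclap \<beta> h M v j k))"
  proof (rule sum_mono, clarify)
    fix j k assume jk: "(j, k) \<in> idx M"
    have "(\<Sum>i\<in>{1..n+1}. c i * ((U i j k)\<^sup>2 - (U (i - 1) j k)\<^sup>2)) / 2
        \<le> (\<sigma> * U (n + 1) j k + (1 - \<sigma>) * U n j k) * (\<Sum>i\<in>{1..n+1}. c i * (U i j k - U (i - 1) j k))"
      unfolding c_def using \<alpha> \<sigma> ccf_first_pos[of n] ccf_mono ccf_last_weighted[of n]
      by (intro weighted_average_energy) auto
    also have "(\<Sum>i\<in>{1..n+1}. c i * (U i j k - U (i - 1) j k)) = f j k - Re (fraclap \<beta> h M v j k)"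
      using arg_cong[OF scheme[OF jk], of Re]
      by (simp only: plus_complex.sel Re_complex_of_real c_def v_def eq_diff_eq)
    finally show "(\<Sum>i\<in>{1..n+1}. c i * ((U i j k)\<^sup>2 - (U (i - 1) j k)\<^sup>2)) / 2
        \<le> v j k * f j k - v j k * Re (fraclap \<beta> h M v j k)"
      by (simp only: v_def right_diff_distrib)
  qed
  also have "\<dots> = (\<Sum>(j, k)\<in>idx M. v j k * f j k) - (\<Sum>(j, k)\<in>idx M. v j k * Re (fraclap \<beta> h M v j k))"
    by (simp add: case_prod_beta sum_subtractf)
  also have "\<dots> \<le> (\<Sum>(j, k)\<in>idx M. v j k * f j k) - lam * E v"
    using fraclap_coercive[OF assms(1-4), of v] by (simp add: lam_def E_def)
  \<comment> \<open>Young's inequality weighted by the coercivity constant, so that its first term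
    cancels \<open>lam * E v\<close>.\<close>
  also have "(\<Sum>(j, k)\<in>idx M. v j k * f j k) \<le> (\<Sum>(j, k)\<in>idx M. lam * (v j k)\<^sup>2 + (f j k)\<^sup>2 / (4 * lam))"
  proof (rule sum_mono, clarify)
    fix j k
    have "0 \<le> (2 * lam * v j k - f j k)\<^sup>2 / (4 * lam)" using lam by simp
    also have "\<dots> = lam * (v j k)\<^sup>2 + (f j k)\<^sup>2 / (4 * lam) - v j k * f j k"
      using lam by (simp add: field_simps power2_eq_square)
    finally show "v j k * f j k \<le> lam * (v j k)\<^sup>2 + (f j k)\<^sup>2 / (4 * lam)" by simp
  qed
  also have "\<dots> = lam * E v + E f / (4 * lam)"
    by (simp add: E_def case_prod_beta sum.distrib sum_distrib_left sum_divide_distrib)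
  finally have "(\<Sum>i\<in>{1..n+1}. c i * (E (U i) - E (U (i - 1)))) \<le> E f / (2 * lam)"
    by (simp add: field_simps)
  then have "h\<^sup>2 * (\<Sum>i\<in>{1..n+1}. c i * (E (U i) - E (U (i - 1)))) \<le> h\<^sup>2 * (E f / (2 * lam))"
    by (rule mult_left_mono) simp
  moreover have "h\<^sup>2 * (\<Sum>i\<in>{1..n+1}. c i * (E (U i) - E (U (i - 1))))
      = (\<Sum>i\<in>{1..n+1}. c i * (h\<^sup>2 * E (U i) - h\<^sup>2 * E (U (i - 1))))"
    unfolding sum_distrib_left by (intro sum.cong refl) (simp add: algebra_simps)
  ultimately show ?thesis
    unfolding E c_def lam_def[symmetric] by simp
qed

lemma (in log_grid) scheme_stability:
  fixes U :: "nat \<Rightarrow> int \<Rightarrow> int \<Rightarrow> real" and F :: "real \<Rightarrow> int \<Rightarrow> int \<Rightarrow> real"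
  assumes "0 < \<beta>" "0 < L" "0 < M" "h = 2 * L / real M" "1 \<le> n"
    and scheme: "\<And>m j k. m < n \<Longrightarrow> (j, k) \<in> idx M \<Longrightarrow>
      complex_of_real (\<Sum>i\<in>{1..m+1}. ccf \<alpha> \<sigma> a \<tau> i m * (U i j k - U (i - 1) j k))
        + fraclap \<beta> h M (\<lambda>p q. \<sigma> * U (m + 1) p q + (1 - \<sigma>) * U m p q) j k
      = complex_of_real (F (real m + \<sigma>) j k)"
  shows "gnorm2 h M (U n) \<le> gnorm2 h M (U 0)
    + Gamma (1 - \<alpha>) / (2 * (3 / 4 * (2 * L) powr (- \<beta>)) * a powr \<alpha>)
      * Max ((\<lambda>k. ((real k + \<sigma>) * \<tau>) powr \<alpha> * gnorm2 h M (F (real k + \<sigma>))) ` {0..n - 1})"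
proof -
  define lam where "lam = 3 / 4 * (2 * L) powr (- \<beta>)"
  have lam: "0 < lam" using assms by (simp add: lam_def)
  define G where "G = (\<lambda>k::nat. ((real k + \<sigma>) * \<tau>) powr \<alpha> * gnorm2 h M (F (real k + \<sigma>)))"
  define K where "K = Gamma (1 - \<alpha>) / (2 * lam * a powr \<alpha>)"
  define B where "B = K * Max (G ` {0..n - 1})"
  have K: "0 < K" using lam a \<alpha> Gamma_real_pos[of "1 - \<alpha>"] by (simp add: K_def)
  have G: "K * G k \<le> B" if "k < n" for k
    unfolding B_def using K that by (intro mult_left_mono Max_ge) auto
  have "0 \<le> K * G 0" using K by (simp add: G_def gnorm2_nonneg)
  then have B: "0 \<le> B" using G[of 0] assms by simp
  have "gnorm2 h M (U m) \<le> gnorm2 h M (U 0) + B" if "m \<le> n" for m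
    using that
  proof (induction m rule: less_induct)
    case (less m)
    show ?case
    proof (cases m)
      case 0
      then show ?thesis using B by simp
    next
      case (Suc k)
      let ?c = "ccf \<alpha> \<sigma> a \<tau> 1 k"
      have "(\<Sum>i\<in>{1..k+1}. ccf \<alpha> \<sigma> a \<tau> i k * (gnorm2 h M (U i) - gnorm2 h M (U (i - 1))))
          \<le> gnorm2 h M (F (real k + \<sigma>)) / (2 * lam)"
        unfolding lam_def
        using Suc less.prems by (intro scheme_energy_estimate[OF assms(1-4)] scheme) auto
      also have "\<dots> = a powr \<alpha> * (gnorm2 h M (F (real k + \<sigma>)) / (2 * lam * a powr \<alpha>))"
        using a by simp
      \<comment> \<open>Trading a powr \<alpha> for the first coefficient gives the source term the
        form \<open>?c * B\<close> that the Gronwall step requires, with \<open>B\<close> the same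
        at every level.\<close>
      also have "\<dots> \<le> Gamma (1 - \<alpha>) * ((real k + \<sigma>) * \<tau>) powr \<alpha> * ?c
          * (gnorm2 h M (F (real k + \<sigma>)) / (2 * lam * a powr \<alpha>))"
        using lam by (intro mult_right_mono ccf_first_ge) (auto simp: gnorm2_nonneg)
      also have "\<dots> = ?c * (K * G k)" by (simp add: K_def G_def)
      also have "\<dots> \<le> ?c * B"
        using G[of k] Suc less.prems ccf_first_pos[of k] by (intro mult_left_mono) auto
      finally have "gnorm2 h M (U (k + 1)) \<le> gnorm2 h M (U 0) + B"
        using Suc less ccf_first_pos[of k] ccf_mono
        by (intro discrete_fractional_gronwall_step[of "\<lambda>i. ccf \<alpha> \<sigma> a \<tau> i k"]) auto
      then show ?thesis using Suc by simp
    qed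
  qed
  from this[of n] show ?thesis by (simp add: B_def K_def G_def lam_def)
qed

theorem theorem3p3:
  fixes \<alpha> \<beta> \<sigma> a T L :: real
  assumes "0 < \<alpha>" "\<alpha> < 1" "1 < \<beta>" "\<beta> < 2" "\<sigma> = 1 - \<alpha> / 2"
    and "0 < a" "a < T" "0 < L"
  shows "\<exists>C > 0. \<exists>\<tau>0 > 0. \<exists>h0 > 0.
    \<forall>(N::nat) (M::nat) (u0::real \<Rightarrow> real \<Rightarrow> real) (f::real \<Rightarrow> real \<Rightarrow> real \<Rightarrow> real)
      (U::nat \<Rightarrow> int \<Rightarrow> int \<Rightarrow> real).
      (let \<tau> = (T - a) / real N; h = 2 * L / real M;
           x = (\<lambda>j::int. - L + real_of_int j * h);
           F = (\<lambda>s::real. \<lambda>j k. f (x j) (x k) (tg a \<tau> s))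
       in 0 < N \<longrightarrow> 0 < M \<longrightarrow> \<tau> \<le> \<tau>0 \<longrightarrow> h \<le> h0 \<longrightarrow>
          (\<forall>j k. 1 \<le> j \<longrightarrow> j \<le> int M - 1 \<longrightarrow> 1 \<le> k \<longrightarrow> k \<le> int M - 1 \<longrightarrow>
               U 0 j k = u0 (x j) (x k)) \<longrightarrow>
          (\<forall>n\<le>N. \<forall>j k. 0 \<le> j \<longrightarrow> j \<le> int M \<longrightarrow> 0 \<le> k \<longrightarrow> k \<le> int M \<longrightarrow>
               (j = 0 \<or> j = int M \<or> k = 0 \<or> k = int M) \<longrightarrow> U n j k = 0) \<longrightarrow>
          (\<forall>n<N. \<forall>j k. 1 \<le> j \<longrightarrow> j \<le> int M - 1 \<longrightarrow> 1 \<le> k \<longrightarrow> k \<le> int M - 1 \<longrightarrow>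
               complex_of_real (\<Sum>i\<in>{1..n+1}. ccf \<alpha> \<sigma> a \<tau> i n * (U i j k - U (i - 1) j k))
               + fraclap \<beta> h M (\<lambda>p q. \<sigma> * U (n + 1) p q + (1 - \<sigma>) * U n p q) j k
               = complex_of_real (f (x j) (x k) (tg a \<tau> (real n + \<sigma>)))) \<longrightarrow>
          (\<forall>n. 1 \<le> n \<longrightarrow> n \<le> N \<longrightarrow>
               gnorm2 h M (U n) \<le> gnorm2 h M (U 0)
                 + 8 * pi powr (2 + \<beta>) * Gamma (1 - \<alpha>) / (C * a powr \<alpha> * 2 powr (3 * \<beta> / 2))
                   * Max ((\<lambda>k. ((real k + \<sigma>) * \<tau>) powr \<alpha> * gnorm2 h M (F (real k + \<sigma>))) ` {0..n - 1})))"
proof -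
  define lam where "lam = 3 / 4 * (2 * L) powr (- \<beta>)"
  \<comment> \<open>Chosen so that the stated constant equals Gamma (1 - \<alpha>) / (2 lam a powr
    \<alpha>); it depends on \<beta> and L alone.\<close>
  define C where "C = 16 * pi powr (2 + \<beta>) * lam / 2 powr (3 * \<beta> / 2)"
  have lam: "0 < lam" using assms by (simp add: lam_def)
  have C: "0 < C" using lam by (simp add: C_def)
  have K: "8 * pi powr (2 + \<beta>) * Gamma (1 - \<alpha>) / (C * a powr \<alpha> * 2 powr (3 * \<beta> / 2))
      = Gamma (1 - \<alpha>) / (2 * lam * a powr \<alpha>)"
    using lam assms by (simp add: C_def field_simps)
  show ?thesis
  \<comment> \<open>The threshold a/2 for the time step is the bound assumed in
    \<open>log_grid\<close>.\<close>
  proof (rule exI[of _ C], rule conjI[OF C], rule exI[of _ "a / 2"], rule conjI[OF half_gt_zero[OF assms(6)]],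
      rule exI[of _ 1], rule conjI[OF zero_less_one], unfold Let_def K, intro allI impI)
    fix N M n :: nat and u0 :: "real \<Rightarrow> real \<Rightarrow> real" and f :: "real \<Rightarrow> real \<Rightarrow> real \<Rightarrow> real"
      and U :: "nat \<Rightarrow> int \<Rightarrow> int \<Rightarrow> real"
    let ?\<tau> = "(T - a) / real N" and ?h = "2 * L / real M"
    let ?x = "\<lambda>j::int. - L + real_of_int j * ?h"
    let ?F = "\<lambda>s::real. \<lambda>j k. f (?x j) (?x k) (tg a ?\<tau> s)"
    assume N: "0 < N" and M: "0 < M" and small: "?\<tau> \<le> a / 2" and n: "1 \<le> n" "n \<le> N"
      and scheme: "\<forall>n<N. \<forall>j k. 1 \<le> j \<longrightarrow> j \<le> int M - 1 \<longrightarrow> 1 \<le> k \<longrightarrow> k \<le> int M - 1 \<longrightarrow>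
               complex_of_real (\<Sum>i\<in>{1..n+1}. ccf \<alpha> \<sigma> a ?\<tau> i n * (U i j k - U (i - 1) j k))
               + fraclap \<beta> ?h M (\<lambda>p q. \<sigma> * U (n + 1) p q + (1 - \<sigma>) * U n p q) j k
               = complex_of_real (f (?x j) (?x k) (tg a ?\<tau> (real n + \<sigma>)))"
    interpret log_grid \<alpha> \<sigma> a ?\<tau>
      using assms N small by unfold_locales auto
    show "gnorm2 ?h M (U n) \<le> gnorm2 ?h M (U 0) + Gamma (1 - \<alpha>) / (2 * lam * a powr \<alpha>)
        * Max ((\<lambda>k. ((real k + \<sigma>) * ?\<tau>) powr \<alpha> * gnorm2 ?h M (?F (real k + \<sigma>))) ` {0..n - 1})"
      unfolding lam_def
      by (rule scheme_stability[where F = ?F])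
        (use assms M n scheme in \<open>auto simp: idx_def simp del: sum.cl_ivl_Suc of_real_sum\<close>)
  qed
qed

end
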